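(* For every function $r\colon\mathbb{N}\to\mathbb{R}_{>0}$ with $\lim_{t\to\infty} r_t/t=0$, there exist mutually absolutely continuous CDFs $F_-$ and $F_+$ yielding unbounded signals such that, in the social learning model with these signal distributions, $$\liminf_{t\to\infty}\frac{|\ell_t|}{r_t}>0$$ with probability $1$.
   Context: Social learning model. A state $\theta\in\{-1,+1\}$ is drawn with $\mathbb{P}(\theta=+1)=\mathbb{P}(\theta=-1)=1/2$. Agents $t=1,2,\dots$ receive private signals $s_t\in\mathbb{R}$ that are i.i.d. conditionally on $\theta$, with CDF $F_+$ if $\theta=+1$ and $F_-$ if $\theta=-1$; $F_+$ and $F_-$ are mutually absolutely continuous. Let $L_t=\log\frac{\mathbb{P}(\theta=+1\mid s_t)}{\mathbb{P}(\theta=-1\mid s_t)}$ be the private log-likelihood ratio, and let $G_+$, $G_-$ denote the CDFs of $L_t$ conditional on $\theta=+1$, $\theta=-1$ respectively. Signals are assumed unbounded: for every $M\in\mathbb{R}$, $\mathbb{P}(L_t>M)>0$ and $\mathbb{P}(L_t<-M)>0$. Agent $t$ observes $a_1,\dots,a_{t-1}$ and her own signal and chooses $a_t\in\{-1,+1\}$ (utility $1$ if $a_t=\theta$, else $0$). The public belief is $\mu_t=\mathbb{P}(\theta=+1\mid a_1,\dots,a_{t-1})$ and $\ell_t=\log\frac{\mu_t}{1-\mu_t}$ (so $\ell_1=0$). In equilibrium $a_t=+1$ iff $\ell_t+L_t>0$, and otherwise $a_t=-1$. Consequently $\ell_{t+1}=\ell_t+D_+(\ell_t)$ if $a_t=+1$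 and $\ell_{t+1}=\ell_t+D_-(\ell_t)$ if $a_t=-1$, where $D_+(x)=\log\frac{1-G_+(-x)}{1-G_-(-x)}$ and $D_-(x)=\log\frac{G_+(-x)}{G_-(-x)}$. We write $\mathbb{P}_+(\cdot)=\mathbb{P}(\cdot\mid\theta=+1)$ and $\mathbb{E}_+$ for the corresponding expectation. *)

theory Defs
  imports "HOL-Probability.Probability"
begin

text \<open>Signal distributions are Borel probability measures Fp (state +1) and Fm (state -1)
on the reals (equivalently, their CDFs F_+ and F_-).\<close>

text \<open>Private log-likelihood ratio: with prior 1/2, P(theta=+1|s)/P(theta=-1|s) = dF_+/dF_-(s).\<close>
definition llr :: "real measure \<Rightarrow> real measure \<Rightarrow> real \<Rightarrow> real" where
  "llr Fp Fm s = ln (enn2real (RN_deriv Fm Fp s))"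

definition Gp :: "real measure \<Rightarrow> real measure \<Rightarrow> real \<Rightarrow> real" where
  "Gp Fp Fm x = measure Fp {s \<in> space Fp. llr Fp Fm s \<le> x}"

definition Gm :: "real measure \<Rightarrow> real measure \<Rightarrow> real \<Rightarrow> real" where
  "Gm Fp Fm x = measure Fm {s \<in> space Fm. llr Fp Fm s \<le> x}"

definition Dp :: "real measure \<Rightarrow> real measure \<Rightarrow> real \<Rightarrow> real" where
  "Dp Fp Fm x = ln ((1 - Gp Fp Fm (- x)) / (1 - Gm Fp Fm (- x)))"

definition Dm :: "real measure \<Rightarrow> real measure \<Rightarrow> real \<Rightarrow> real" where
  "Dm Fp Fm x = ln (Gp Fp Fm (- x) / Gm Fp Fm (- x))"

text \<open>Unbounded signals: for every M, P(L > M) > 0 and P(L < -M) > 0, where P is the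
unconditional law of the signal (the 1/2-1/2 mixture of Fp and Fm).\<close>
definition unbounded_signals :: "real measure \<Rightarrow> real measure \<Rightarrow> bool" where
  "unbounded_signals Fp Fm \<longleftrightarrow>
     (\<forall>M::real.
        (measure Fp {s \<in> space Fp. llr Fp Fm s > M} + measure Fm {s \<in> space Fm. llr Fp Fm s > M}) / 2 > 0 \<and>
        (measure Fp {s \<in> space Fp. llr Fp Fm s < - M} + measure Fm {s \<in> space Fm. llr Fp Fm s < - M}) / 2 > 0)"

text \<open>Public log-likelihood ratio. Agents are t = 1, 2, ...; agent t has signal s t
(s 0 is unused).  pub_llr .. s t = ell_t for t \<ge> 1 (the value at t = 0 is a dummy 0).
ell_1 = 0, and ell_(t+1) = ell_t + D_+(ell_t) if a_t = +1 (i.e. ell_t + L_t > 0),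
otherwise ell_t + D_-(ell_t).\<close>
primrec pub_llr :: "real measure \<Rightarrow> real measure \<Rightarrow> (nat \<Rightarrow> real) \<Rightarrow> nat \<Rightarrow> real" where
  "pub_llr Fp Fm s 0 = 0"
| "pub_llr Fp Fm s (Suc t) =
     (if t = 0 then 0
      else (let l = pub_llr Fp Fm s t in
            if l + llr Fp Fm (s t) > 0 then l + Dp Fp Fm l else l + Dm Fp Fm l))"

text \<open>Joint law of the signal sequence: theta uniform on {-1,+1} (True = +1), then
signals i.i.d. Fp if theta = +1 and i.i.d. Fm if theta = -1.\<close>
definition signal_law :: "real measure \<Rightarrow> real measure \<Rightarrow> (nat \<Rightarrow> real) measure" where
  "signal_law Fp Fm =
     measure_pmf (bernoulli_pmf (1/2)) \<bind> (\<lambda>\<theta>. PiM UNIV (\<lambda>_::nat. if \<theta> then Fp else Fm))"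

end

theory Submission
  imports Defs
begin

text \<open>
  Write \<open>G\<^sub>+\<close>, \<open>G\<^sub>-\<close> for the conditional distribution functions of the private log-likelihood
  ratio and condition on \<open>\<theta> = +1\<close>. In each step the conditional expectation of \<open>exp (- \<ell> / 2)\<close> is
  multiplied by the Hellinger affinity of the two action distributions, which stays below 1 by at
  least a multiple of \<open>G\<^sub>- (- \<ell>)\<close> if \<open>\<ell> \<ge> 0\<close> and of \<open>1 - G\<^sub>+ (- \<ell>)\<close> if \<open>\<ell> < 0\<close>. If these tails decay
  no faster than \<open>exp (- \<bar>\<ell>\<bar> / 2)\<close>, the probabilities of a wrong action or a negative \<open>\<ell>\<close> are
  therefore summable in time, and by Borel-Cantelli almost surely all but finitely many agents act
  correctly with \<open>\<ell> \<ge> 0\<close>. From then on \<open>\<ell>\<close> grows in each step by at least a multiple of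
  \<open>G\<^sub>- (- \<ell>)\<close>, so that \<open>\<ell>\<^sub>t\<close> is eventually at least a multiple of \<open>t G\<^sub>- (- \<ell>\<^sub>t)\<close>; hence it is enough
  that \<open>G\<^sub>- (- r\<^sub>t)\<close> is at least a multiple of \<open>r\<^sub>t / t\<close>. As \<open>r\<^sub>t / t \<longlonglongrightarrow> 0\<close>, a symmetric signal distribution
  with such slowly decaying tails exists. The state \<open>\<theta> = -1\<close> is the mirror image.
\<close>

section \<open>Markov chains driven by i.i.d. noise\<close>

primrec chain :: "('a \<Rightarrow> 's \<Rightarrow> 'a) \<Rightarrow> 'a \<Rightarrow> (nat \<Rightarrow> 's) \<Rightarrow> nat \<Rightarrow> 'a" where
  "chain f x w 0 = x"
| "chain f x w (Suc t) = f (chain f x w t) (w t)"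

lemma chain_case_nat: "chain f x (case_nat s w) (Suc t) = chain f (f x s) w t"
  by (induction t) auto

lemma measurable_chain:
  assumes [measurable]: "(\<lambda>(x, s). f x s) \<in> N \<Otimes>\<^sub>M M \<rightarrow>\<^sub>M N"
  shows "(\<lambda>(x, w). chain f x w t) \<in> N \<Otimes>\<^sub>M PiM UNIV (\<lambda>_::nat. M) \<rightarrow>\<^sub>M N"
proof (induction t)
  case 0
  then show ?case by simp
next
  case (Suc t)
  note Suc[measurable]
  have "(\<lambda>p. (\<lambda>(x, s). f x s) ((\<lambda>(x, w). chain f x w t) p, snd p t))
      \<in> N \<Otimes>\<^sub>M PiM UNIV (\<lambda>_::nat. M) \<rightarrow>\<^sub>M N"
    by measurable
  then show ?case
    by (simp add: case_prod_beta)
qed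

text \<open>The function \<open>V\<close> is a Lyapunov function that pays for each step's cost. The
  induction peels off the first noise variable: the i.i.d. law is the image of its product with
  \<open>M\<close> under \<open>case_nat\<close>, and the remaining chain starts afresh from
  \<open>f x s\<close>, hence the arbitrary \<open>x\<close>.\<close>

lemma (in prob_space) chain_cost_bound:
  fixes f :: "'b \<Rightarrow> 'a \<Rightarrow> 'b" and V :: "'b \<Rightarrow> ennreal"
  assumes f[measurable]: "(\<lambda>(x, s). f x s) \<in> N \<Otimes>\<^sub>M M \<rightarrow>\<^sub>M N"
    and h[measurable]: "(\<lambda>(x, s). h x s) \<in> borel_measurable (N \<Otimes>\<^sub>M M)"
    and V: "\<And>x. x \<in> space N \<Longrightarrow> (\<integral>\<^sup>+s. h x s + V (f x s) \<partial>M) \<le> V x"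
    and Vm[measurable]: "V \<in> borel_measurable N"
    and x: "x \<in> space N"
  shows "(\<integral>\<^sup>+w. (\<Sum>t<n. h (chain f x w t) (w t)) \<partial>PiM UNIV (\<lambda>_::nat. M)) \<le> V x"
  using x
proof (induction n arbitrary: x)
  case 0
  then show ?case by simp
next
  case (Suc n)
  have "prob_space M" by unfold_locales
  then interpret S: prob_space "PiM UNIV (\<lambda>_::nat. M)" by (intro prob_space_PiM)
  interpret sequence_space M ..
  note measurable_chain[OF f, measurable]
  have hc[measurable]: "(\<lambda>(x, w). h (chain f x w t) (w t)) \<in> borel_measurable (N \<Otimes>\<^sub>M S)" for t
  proof -
    have "(\<lambda>p. (\<lambda>(x, s). h x s) ((\<lambda>(x, w). chain f x w t) p, snd p t)) \<in> borel_measurable (N \<Otimes>\<^sub>M S)"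
      by measurable
    then show ?thesis by (simp add: case_prod_beta)
  qed
  define H where "H = (\<lambda>x w n. \<Sum>t<n. h (chain f x w t) (w t))"
  have Hm[measurable]: "(\<lambda>(x, w). H x w n) \<in> borel_measurable (N \<Otimes>\<^sub>M S)" for n
    unfolding H_def case_prod_beta using hc unfolding case_prod_beta by (intro borel_measurable_sum) auto
  have H_Suc: "H x (case_nat s w) (Suc n) = h x s + H (f x s) w n" for s w
    unfolding H_def by (subst sum.lessThan_Suc_shift) (simp only: chain_case_nat, simp)
  have hx[measurable]: "h x \<in> borel_measurable M"
    using measurable_compose[OF measurable_Pair1'[OF \<open>x \<in> space N\<close>] h] by simp
  have fx[measurable]: "f x \<in> M \<rightarrow>\<^sub>M N"
    using measurable_compose[OF measurable_Pair1'[OF \<open>x \<in> space N\<close>] f] by simp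
  have Hx[measurable]: "(\<lambda>w. H x w (Suc n)) \<in> borel_measurable S"
    using measurable_compose[OF measurable_Pair1'[OF \<open>x \<in> space N\<close>] Hm] by simp
  have Hf[measurable]: "(\<lambda>(s, w). H (f x s) w n) \<in> borel_measurable (M \<Otimes>\<^sub>M S)"
  proof -
    have "(\<lambda>p. (\<lambda>(x, w). H x w n) (f x (fst p), snd p)) \<in> borel_measurable (M \<Otimes>\<^sub>M S)"
      by measurable
    then show ?thesis by (simp add: case_prod_beta)
  qed
  have cn[measurable]: "(\<lambda>(s, w). case_nat s w) \<in> M \<Otimes>\<^sub>M S \<rightarrow>\<^sub>M S"
    unfolding case_prod_beta by measurable
  have "(\<integral>\<^sup>+w. H x w (Suc n) \<partial>S) =
      (\<integral>\<^sup>+w. H x w (Suc n) \<partial>distr (M \<Otimes>\<^sub>M S) S (\<lambda>(s, w). case_nat s w))"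
    by (simp only: PiM_iter)
  also have "\<dots> = (\<integral>\<^sup>+p. h x (fst p) + H (f x (fst p)) (snd p) n \<partial>(M \<Otimes>\<^sub>M S))"
    by (subst nn_integral_distr) (auto simp: case_prod_beta H_Suc)
  also have "\<dots> = (\<integral>\<^sup>+s. (\<integral>\<^sup>+w. h x s + H (f x s) w n \<partial>S) \<partial>M)"
    using Hf by (subst S.nn_integral_fst[symmetric]) (auto simp: case_prod_beta)
  also have "\<dots> \<le> (\<integral>\<^sup>+s. h x s + V (f x s) \<partial>M)"
  proof (rule nn_integral_mono)
    fix s assume s: "s \<in> space M"
    have fs: "f x s \<in> space N" using measurable_space[OF fx s] .
    have "(\<lambda>w. H (f x s) w n) \<in> borel_measurable S"
      using measurable_compose[OF measurable_Pair1'[OF fs] Hm] by simp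
    then have "(\<integral>\<^sup>+w. h x s + H (f x s) w n \<partial>S) = h x s + (\<integral>\<^sup>+w. H (f x s) w n \<partial>S)"
      by (subst nn_integral_add) (auto simp: S.emeasure_space_1)
    also have "\<dots> \<le> h x s + V (f x s)"
      using Suc.IH[OF fs] unfolding H_def by (intro add_left_mono)
    finally show "(\<integral>\<^sup>+w. h x s + H (f x s) w n \<partial>S) \<le> h x s + V (f x s)" .
  qed
  also have "\<dots> \<le> V x" by (rule V) fact
  finally show ?case unfolding H_def .
qed

text \<open>Charging \<open>c\<close> for each bad step bounds the expected number of bad steps by
  \<open>V x / c\<close>, so Borel-Cantelli applies.\<close>

lemma (in prob_space) chain_eventually_not_bad:
  fixes f :: "'b \<Rightarrow> 'a \<Rightarrow> 'b" and V :: "'b \<Rightarrow> ennreal"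
  assumes f[measurable]: "(\<lambda>(x, s). f x s) \<in> N \<Otimes>\<^sub>M M \<rightarrow>\<^sub>M N"
    and bad[measurable]: "Measurable.pred (N \<Otimes>\<^sub>M M) (\<lambda>(x, s). bad x s)"
    and V: "\<And>x. x \<in> space N \<Longrightarrow>
        (\<integral>\<^sup>+s. ennreal c * indicator {s. bad x s} s + V (f x s) \<partial>M) \<le> V x"
    and Vm[measurable]: "V \<in> borel_measurable N"
    and x: "x \<in> space N" and c: "c > 0" and fin: "V x < \<infinity>"
  shows "AE w in PiM UNIV (\<lambda>_::nat. M). \<forall>\<^sub>F t in sequentially. \<not> bad (chain f x w t) (w t)"
proof -
  have "prob_space M" by unfold_locales
  then interpret S: prob_space "PiM UNIV (\<lambda>_::nat. M)" by (intro prob_space_PiM)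
  interpret sequence_space M ..
  define A where "A t = {w \<in> space S. bad (chain f x w t) (w t)}" for t
  have chx[measurable]: "(\<lambda>w. chain f x w t) \<in> S \<rightarrow>\<^sub>M N" for t
    using measurable_compose[OF measurable_Pair1'[OF x] measurable_chain[OF f]] by simp
  have "Measurable.pred S (\<lambda>w. (\<lambda>(x, s). bad x s) (chain f x w t, w t))" for t
    by measurable
  then have A[measurable]: "A t \<in> sets S" for t
    unfolding A_def by (simp add: pred_def)
  have hm: "(\<lambda>(x, s). ennreal c * indicator {s. bad x s} s) \<in> borel_measurable (N \<Otimes>\<^sub>M M)"
  proof -
    have "(\<lambda>p. ennreal c * indicator {p. (\<lambda>(x, s). bad x s) p} p) \<in> borel_measurable (N \<Otimes>\<^sub>M M)"
      by measurable
    then show ?thesis by (simp add: case_prod_beta indicator_def)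
  qed
  have "(\<Sum>t<n. measure S (A t)) \<le> enn2real (V x) / c" for n
  proof -
    have "ennreal (c * (\<Sum>t<n. measure S (A t))) = (\<Sum>t<n. ennreal c * emeasure S (A t))"
      using c by (simp add: S.emeasure_eq_measure sum_distrib_left sum_ennreal ennreal_mult' sum_nonneg flip: ennreal_mult')
    also have "\<dots> = (\<Sum>t<n. \<integral>\<^sup>+w. ennreal c * indicator (A t) w \<partial>S)"
      by (simp add: nn_integral_cmult)
    also have "\<dots> = (\<integral>\<^sup>+w. (\<Sum>t<n. ennreal c * indicator (A t) w) \<partial>S)"
      by (subst nn_integral_sum) auto
    also have "\<dots> = (\<integral>\<^sup>+w. (\<Sum>t<n. ennreal c * indicator {s. bad (chain f x w t) s} (w t)) \<partial>S)"
      by (intro nn_integral_cong sum.cong) (auto simp: A_def indicator_def)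
    also have "\<dots> \<le> V x"
      by (rule chain_cost_bound[OF f hm V Vm x])
    also have "\<dots> = ennreal (enn2real (V x))" using fin by simp
    finally have "c * (\<Sum>t<n. measure S (A t)) \<le> enn2real (V x)"
      by (subst (asm) ennreal_le_iff) auto
    then show ?thesis using c by (simp add: field_simps)
  qed
  then have "summable (\<lambda>t. measure S (A t))"
    by (intro summableI_nonneg_bounded) auto
  then have "AE w in S. \<forall>\<^sub>F t in sequentially. w \<in> space S - A t"
    by (intro borel_cantelli_AE1) (auto simp: S.emeasure_eq_measure)
  then show ?thesis
    by eventually_elim (auto elim!: eventually_mono simp: A_def)
qed

section \<open>Herding\<close>

text \<open>By AM-GM on the first root, the affinity is at most
  \<open>1 - (sqrt b - sqrt a)\<^sup>2 / 2\<close>. Since \<open>sqrt a\<close> is at most half of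
  \<open>sqrt b\<close>, that square is at least \<open>b / 4\<close>.\<close>

lemma hellinger_affinity_le:
  fixes a b :: real
  assumes "0 < a" "a \<le> b / 4" "b < 1"
  shows "sqrt ((1 - a) * (1 - b)) + sqrt (a * b) \<le> 1 - b / 8"
proof -
  have "sqrt ((1 - a) * (1 - b)) \<le> ((1 - a) + (1 - b)) / 2"
    using assms by (intro arith_geo_mean_sqrt) auto
  moreover have "sqrt a \<le> sqrt b / 2"
    using real_sqrt_le_mono[OF assms(2)] by (simp add: real_sqrt_divide)
  then have "(sqrt b / 2)\<^sup>2 \<le> (sqrt b - sqrt a)\<^sup>2"
    using assms by (intro power_mono) (auto simp: field_simps)
  then have "b / 4 \<le> a + b - 2 * sqrt (a * b)"
    using assms by (simp add: power2_diff power_divide real_sqrt_mult mult_ac)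
  ultimately show ?thesis by (simp add: field_simps)
qed

text \<open>An action with probability \<open>p\<close> under the true state and \<open>q\<close>
  under the false one contributes one summand of the Hellinger affinity to the expectation of
  \<open>exp (- y / 2)\<close>.\<close>

lemma exp_half_ln_step:
  fixes p q :: real
  assumes "p > 0" "q > 0"
  shows "p * exp (- (y + ln (p / q)) / 2) = exp (- y / 2) * sqrt (p * q)"
proof -
  have "exp (- (y + ln (p / q)) / 2) = exp (- y / 2) * exp (ln (q / p) / 2)"
    using assms by (simp add: ln_div diff_divide_distrib add_divide_distrib flip: exp_add)
  also have "exp (ln (q / p) / 2) = sqrt (q / p)"
    using assms by (intro real_sqrt_unique[symmetric]) (auto simp: power2_eq_square simp flip: exp_add)
  also have "p * (exp (- y / 2) * sqrt (q / p)) = exp (- y / 2) * sqrt (p * q)"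
    using assms by (simp add: real_sqrt_divide real_sqrt_mult field_simps)
  finally show ?thesis .
qed

text \<open>Bounding the logarithm of the inverse ratio by that ratio minus 1 leaves an increment of
  at least \<open>b - a\<close>.\<close>

lemma ln_step_ge:
  fixes a b :: real
  assumes "0 < a" "a \<le> b / 4" "b < 1"
  shows "3 / 4 * b \<le> ln ((1 - a) / (1 - b))"
proof -
  have "ln ((1 - b) / (1 - a)) \<le> (1 - b) / (1 - a) - 1"
    using assms by (intro ln_le_minus_one) auto
  also have "\<dots> = - ((b - a) / (1 - a))"
    using assms by (simp add: field_simps)
  also have "\<dots> \<le> - (b - a)"
    using assms mult_right_mono[of "1 - a" 1 "b - a"] by (simp add: field_simps)
  finally show ?thesis
    using assms by (simp add: ln_div)
qed

text \<open>If \<open>x t\<close> is still below \<open>r t\<close>, then by monotonicity every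
  increment between \<open>T\<close> and \<open>t\<close> was at least \<open>k * B (r t)\<close>,
  hence at least \<open>k * c * r t / t\<close>. Summing about \<open>t\<close> of them yields a
  multiple of \<open>r t\<close>.\<close>

lemma slow_growth_lower_bound:
  fixes x r B :: "_ \<Rightarrow> real"
  assumes B: "antimono B" "\<And>y. B y \<ge> 0"
    and x: "\<forall>\<^sub>F t in sequentially. 0 \<le> x t \<and> x t + k * B (x t) \<le> x (Suc t)"
    and r: "\<forall>\<^sub>F t in sequentially. c * (r t / real t) \<le> B (r t)"
    and kc: "0 < k" "0 < c"
  shows "\<exists>d>0. \<forall>\<^sub>F t in sequentially. d * r t \<le> x t"
proof -
  obtain T where T: "\<And>t. t \<ge> T \<Longrightarrow> 0 \<le> x t \<and> x t + k * B (x t) \<le> x (Suc t)"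
    using x by (auto simp: eventually_sequentially)
  have step: "x t + k * B (x t) \<le> x (Suc t)" if "t \<ge> T" for t using T[OF that] by auto
  have x_mono: "x s \<le> x t" if "T \<le> s" "s \<le> t" for s t
    using that(2)
  proof (induction rule: dec_induct)
    case (step n)
    have "0 \<le> k * B (x n)" using kc B(2) by simp
    then show ?case using T[of n] step that(1) by auto
  qed simp
  have lin: "real n * (k * B (x t)) \<le> x (T + n)" if "T + n \<le> t" for n t
    using that
  proof (induction n)
    case 0 then show ?case using T[of T] by simp
  next
    case (Suc n)
    have "B (x t) \<le> B (x (T + n))"
      using Suc.prems by (intro antimonoD[OF B(1)] x_mono) auto
    then have "k * B (x t) \<le> k * B (x (T + n))" using kc by simp
    then show ?case using Suc step[of "T + n"] by (simp add: algebra_simps)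
  qed
  have "\<forall>\<^sub>F t in sequentially. min 1 (k * c / 2) * r t \<le> x t"
    \<comment> \<open>This makes \<open>t\<close> positive and leaves at least \<open>t / 2\<close>
      steps after \<open>T\<close>, whence the factor \<open>k * c / 2\<close>.\<close>
    using r eventually_ge_at_top[of "2 * T + 1"]
  proof eventually_elim
    case (elim t)
    have xt: "x t \<ge> 0" using T[of t] elim by auto
    show ?case
    proof (cases "r t \<le> x t")
      case True
      show ?thesis
      proof (cases "r t \<ge> 0")
        case r0: True
        have "min 1 (k * c / 2) * r t \<le> 1 * r t" using r0 by (intro mult_right_mono) auto
        then show ?thesis using True by simp
      next
        case False
        then have "min 1 (k * c / 2) * r t \<le> 0" using kc by (intro mult_nonneg_nonpos) auto
        then show ?thesis using xt by simp
      qed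
    next
      case False
      then have "c * (r t / real t) \<le> B (x t)"
        using antimonoD[OF B(1), of "x t" "r t"] elim by simp
      then have "real (t - T) * (k * (c * (r t / real t))) \<le> real (t - T) * (k * B (x t))"
        using kc by (intro mult_left_mono) auto
      also have "\<dots> \<le> x t" using lin[of "t - T" t] elim by simp
      finally have 1: "real (t - T) * (k * (c * (r t / real t))) \<le> x t" .
      have "min 1 (k * c / 2) * r t \<le> (k * c / 2) * r t"
        using False xt by (intro mult_right_mono) auto
      also have "\<dots> = (real t / 2) * (k * (c * (r t / real t)))"
        using elim by simp
      also have "\<dots> \<le> real (t - T) * (k * (c * (r t / real t)))"
        using elim kc False xt by (intro mult_right_mono) auto
      finally show ?thesis using 1 by simp
    qed
  qed
  moreover have "min 1 (k * c / 2) > 0" using kc by simp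
  ultimately show ?thesis by blast
qed

text \<open>
  The chain is the public log-likelihood ratio, signed so that the true state is positive; the
  wrong action has probability \<open>A\<close> under the true state and \<open>B\<close> under the false one.
\<close>
definition belief_step ::
  "(real \<Rightarrow> real) \<Rightarrow> (real \<Rightarrow> real) \<Rightarrow> (real \<Rightarrow> 's \<Rightarrow> bool) \<Rightarrow> real \<Rightarrow> 's \<Rightarrow> real" where
  "belief_step A B right y s =
     (if right y s then y + ln ((1 - A y) / (1 - B y)) else y + ln (A y / B y))"

text \<open>The factor 4 in \<open>AB\<close> and \<open>BA\<close> says that an action against the
  public belief is much likelier in the state it matches; this feeds
  \<open>hellinger_affinity_le\<close>. The bound with \<open>exp (- y)\<close> pays for wrong
  actions at \<open>y \<ge> 0\<close>, and the bound with \<open>c\<close> for all the time spent at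
  \<open>y < 0\<close>.\<close>

locale belief_chain = prob_space M
  for M :: "'s measure" and A B :: "real \<Rightarrow> real" and right :: "real \<Rightarrow> 's \<Rightarrow> bool" and c :: real +
  assumes A_meas[measurable]: "A \<in> borel_measurable borel"
    and B_meas[measurable]: "B \<in> borel_measurable borel"
    and right[measurable]: "Measurable.pred (borel \<Otimes>\<^sub>M M) (\<lambda>(y, s). right y s)"
    and A: "\<And>y. measure M {s \<in> space M. \<not> right y s} = A y"
    and A01: "\<And>y. 0 < A y" "\<And>y. A y < 1"
    and B01: "\<And>y. 0 < B y" "\<And>y. B y < 1"
    and AB: "\<And>y. 0 \<le> y \<Longrightarrow> A y \<le> B y / 4" "\<And>y. 0 \<le> y \<Longrightarrow> A y \<le> exp (- y) * B y"
    and BA: "\<And>y. y \<le> 0 \<Longrightarrow> 1 - B y \<le> (1 - A y) / 4"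
    and c: "\<And>y. y \<le> 0 \<Longrightarrow> c * exp (y / 2) \<le> 1 - A y" "0 < c" "c \<le> 1"
begin

text \<open>
  \<open>exp (- y / 2)\<close> is a Lyapunov function: its conditional expectation is multiplied in each step
  by the Hellinger affinity of the two action distributions.
\<close>
lemma eventually_correct_herd:
  shows "AE w in PiM UNIV (\<lambda>_::nat. M). \<forall>\<^sub>F t in sequentially.
      0 \<le> chain (belief_step A B right) 0 w t \<and> right (chain (belief_step A B right) 0 w t) (w t)"
proof -
  let ?f = "belief_step A B right"
  define bad where "bad = (\<lambda>y s. y < 0 \<or> \<not> right y s)"
  have f: "(\<lambda>(y, s). ?f y s) \<in> borel \<Otimes>\<^sub>M M \<rightarrow>\<^sub>M borel"
  proof -
    have "(\<lambda>p. if (\<lambda>(y, s). right y s) p then fst p + ln ((1 - A (fst p)) / (1 - B (fst p)))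
        else fst p + ln (A (fst p) / B (fst p))) \<in> borel \<Otimes>\<^sub>M M \<rightarrow>\<^sub>M borel"
      by measurable
    then show ?thesis by (simp add: case_prod_beta belief_step_def)
  qed
  have bad: "Measurable.pred (borel \<Otimes>\<^sub>M M) (\<lambda>(y, s). bad y s)"
  proof -
    have "Measurable.pred (borel \<Otimes>\<^sub>M M) (\<lambda>p. fst p < 0 \<or> \<not> (\<lambda>(y, s). right y s) p)"
      by measurable
    then show ?thesis by (simp add: case_prod_beta bad_def)
  qed
  have drift: "(\<integral>\<^sup>+s. ennreal (c / 8) * indicator {s. bad y s} s + ennreal (exp (- ?f y s / 2)) \<partial>M)
      \<le> ennreal (exp (- y / 2))" for y
  proof -
    have [measurable]: "Measurable.pred M (right y)"
      using measurable_compose[OF measurable_Pair1' right, of y] by simp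
    define u where "u = exp (- (y + ln ((1 - A y) / (1 - B y))) / 2)"
    define d where "d = exp (- (y + ln (A y / B y)) / 2)"
    \<comment> \<open>The cost incurred together with the right action: at negative \<open>y\<close>
      every step counts as bad.\<close>
    define e where "e = (if y < 0 then c / 8 else 0)"
    have e: "e \<ge> 0" using c by (simp add: e_def)
    have ud: "u \<ge> 0" "d \<ge> 0" by (auto simp: u_def d_def)
    have R: "measure M {s \<in> space M. right y s} = 1 - A y"
      using prob_neg[of "right y"] A[of y] by simp
    have "exp (- ?f y s / 2) = (if right y s then u else d)" for s
      by (cases "right y s") (simp_all only: belief_step_def u_def d_def if_True if_False)
    then have "(\<integral>\<^sup>+s. ennreal (c / 8) * indicator {s. bad y s} s + ennreal (exp (- ?f y s / 2)) \<partial>M)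
      = (\<integral>\<^sup>+s. ennreal (e + u) * indicator {s \<in> space M. right y s} s
           + ennreal (c / 8 + d) * indicator {s \<in> space M. \<not> right y s} s \<partial>M)"
      using e ud c by (intro nn_integral_cong)
        (auto simp: bad_def e_def indicator_def)
    also have "\<dots> = ennreal ((e + u) * (1 - A y) + (c / 8 + d) * A y)"
      using e ud c A01[of y] by (subst nn_integral_add)
        (auto simp: nn_integral_cmult emeasure_eq_measure A R ennreal_mult' ennreal_plus
           simp del: ennreal_plus simp flip: ennreal_plus ennreal_mult')
    also have "(e + u) * (1 - A y) + (c / 8 + d) * A y =
        e * (1 - A y) + c / 8 * A y
        + exp (- y / 2) * (sqrt ((1 - A y) * (1 - B y)) + sqrt (A y * B y))"
    proof -
      have "(1 - A y) * u = exp (- y / 2) * sqrt ((1 - A y) * (1 - B y))"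
        unfolding u_def using A01[of y] B01[of y] by (intro exp_half_ln_step) auto
      moreover have "A y * d = exp (- y / 2) * sqrt (A y * B y)"
        unfolding d_def using A01[of y] B01[of y] by (intro exp_half_ln_step) auto
      ultimately show ?thesis by (simp add: algebra_simps)
    qed
    also have "\<dots> \<le> exp (- y / 2)"
    proof (cases "y < 0")
      case True
      \<comment> \<open>For negative \<open>y\<close> the right action is the unlikely one, so the
        affinity bound is applied to the complementary probabilities. Multiplied by
        \<open>exp (- y / 2)\<close>, the loss \<open>c * exp (y / 2) / 8\<close> is exactly the
        cost \<open>c / 8\<close>.\<close>
      have "sqrt ((1 - (1 - B y)) * (1 - (1 - A y))) + sqrt ((1 - B y) * (1 - A y)) \<le> 1 - (1 - A y) / 8"
        using True A01[of y] B01[of y] BA[of y] by (intro hellinger_affinity_le) auto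
      also have "\<dots> \<le> 1 - c * exp (y / 2) / 8"
        using c(1)[of y] True by simp
      finally have "sqrt ((1 - A y) * (1 - B y)) + sqrt (A y * B y) \<le> 1 - c * exp (y / 2) / 8"
        by (simp add: mult.commute add.commute)
      then have "exp (- y / 2) * (sqrt ((1 - A y) * (1 - B y)) + sqrt (A y * B y))
          \<le> exp (- y / 2) * (1 - c * exp (y / 2) / 8)"
        by (intro mult_left_mono) auto
      also have "\<dots> = exp (- y / 2) - c / 8"
        by (simp add: algebra_simps flip: exp_add)
      finally have "exp (- y / 2) * (sqrt ((1 - A y) * (1 - B y)) + sqrt (A y * B y))
          \<le> exp (- y / 2) - c / 8" .
      moreover have "e * (1 - A y) + c / 8 * A y = c / 8"
        using True by (simp add: e_def algebra_simps flip: add_divide_distrib)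
      ultimately show ?thesis by linarith
    next
      case False
      then have y: "y \<ge> 0" by simp
      have "exp (- y / 2) * (sqrt ((1 - A y) * (1 - B y)) + sqrt (A y * B y))
          \<le> exp (- y / 2) * (1 - B y / 8)"
        using y A01[of y] B01[of y] AB[of y] by (intro mult_left_mono hellinger_affinity_le) auto
      moreover have "c / 8 * A y \<le> exp (- y / 2) * (B y / 8)"
      proof -
        have "c * A y \<le> 1 * (exp (- y) * B y)"
          using AB(2)[OF y] c A01(1)[of y] by (intro mult_mono) auto
        also have "\<dots> \<le> exp (- y / 2) * B y"
          using y B01(1)[of y] by (simp add: mult_right_mono)
        finally show ?thesis by simp
      qed
      ultimately show ?thesis using False by (simp add: e_def algebra_simps)
    qed
    finally show ?thesis by (simp add: ennreal_leI)
  qed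
  have "AE w in PiM UNIV (\<lambda>_::nat. M). \<forall>\<^sub>F t in sequentially. \<not> bad (chain ?f 0 w t) (w t)"
    by (rule chain_eventually_not_bad[OF f bad drift]) (use c in auto)
  then show ?thesis by (simp add: bad_def not_less)
qed

text \<open>Agents are numbered from 1, so \<open>x\<close> follows the chain driven by the shifted
  signals; the shift preserves the i.i.d. law.\<close>

lemma belief_rate:
  fixes x :: "(nat \<Rightarrow> 's) \<Rightarrow> nat \<Rightarrow> real"
  assumes B: "antimono B"
    and r: "\<forall>\<^sub>F t in sequentially. c * (r t / real t) \<le> B (r t)"
    and x: "\<And>s t. x s (Suc t) = chain (belief_step A B right) 0 (\<lambda>i. s (Suc i)) t"
  shows "AE s in PiM UNIV (\<lambda>_::nat. M). \<exists>d>0. \<forall>\<^sub>F t in sequentially. d * r t \<le> x s t"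
proof -
  let ?S = "PiM UNIV (\<lambda>_::nat. M)"
  have "prob_space M" by unfold_locales
  then have shift: "distr ?S ?S (\<lambda>s i. s (Suc i)) = ?S"
    using distr_PiM_reindex[of UNIV "\<lambda>_. M" Suc UNIV] by (simp add: restrict_UNIV)
  have "(\<lambda>s i. s (Suc i)) \<in> ?S \<rightarrow>\<^sub>M ?S"
    by (intro measurable_PiM_single') (auto simp: space_PiM)
  from AE_distrD[OF this, unfolded shift, OF eventually_correct_herd]
  have "AE s in ?S. \<forall>\<^sub>F t in sequentially. 0 \<le> x s (Suc t) \<and> right (x s (Suc t)) (s (Suc t))"
    unfolding x .
  then show ?thesis
  proof eventually_elim
    case (elim s)
    have "\<forall>\<^sub>F t in sequentially. 0 \<le> x s (Suc t) \<and> x s (Suc t) + 3 / 4 * B (x s (Suc t)) \<le> x s (Suc (Suc t))"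
      using elim
    proof eventually_elim
      case (elim t)
      have "x s (Suc (Suc t)) = belief_step A B right (x s (Suc t)) (s (Suc t))"
        by (simp add: x)
      also have "\<dots> = x s (Suc t) + ln ((1 - A (x s (Suc t))) / (1 - B (x s (Suc t))))"
        using elim by (simp add: belief_step_def)
      finally show ?case
        using ln_step_ge[OF A01(1) AB(1) B01(2), of "x s (Suc t)"] elim by simp
    qed
    then have "\<forall>\<^sub>F t in sequentially. 0 \<le> x s t \<and> x s t + 3 / 4 * B (x s t) \<le> x s (Suc t)"
      by (rule eventually_sequentially_Suc[THEN iffD1])
    then show ?case
      using B01(1) c by (intro slow_growth_lower_bound[where k = "3 / 4", OF B _ _ r]) (auto simp: less_imp_le)
  qed
qed

end

section \<open>Signals equal to their own log-likelihood ratio\<close>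

lemma measure_density_le:
  fixes f :: "'a \<Rightarrow> real"
  assumes "prob_space M" and N: "prob_space N" "density M (\<lambda>x. ennreal (f x)) = N"
    and [measurable]: "f \<in> borel_measurable M" "X \<in> sets M"
    and K: "AE x in M. x \<in> X \<longrightarrow> f x \<le> K" "0 \<le> K"
  shows "measure N X \<le> K * measure M X"
proof -
  interpret M: prob_space M by fact
  interpret N: prob_space N by fact
  have "emeasure N X = (\<integral>\<^sup>+x. ennreal (f x) * indicator X x \<partial>M)"
    unfolding N(2)[symmetric] by (rule emeasure_density) auto
  also have "\<dots> \<le> (\<integral>\<^sup>+x. ennreal K * indicator X x \<partial>M)"
    using K(1) by (intro nn_integral_mono_AE, eventually_elim) (auto simp: indicator_def intro: ennreal_leI)
  also have "\<dots> = ennreal (K * measure M X)"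
    using K(2) by (simp add: nn_integral_cmult M.emeasure_eq_measure ennreal_mult')
  finally show ?thesis
    using K(2) by (simp add: N.emeasure_eq_measure)
qed

lemma exp_2_ge_4: "4 \<le> exp (2::real)"
proof -
  have "2 * 2 \<le> exp (1::real) * exp 1"
    using exp_ge_add_one_self[of 1] by (intro mult_mono) auto
  then show ?thesis by (simp flip: exp_add)
qed

text \<open>The density \<open>exp s\<close> makes a signal its own log-likelihood ratio. The gap
  around 0 yields the factor 4 required by \<open>belief_chain\<close>, because
  \<open>exp 2 \<ge> 4\<close>; the exponent \<open>- x / 2\<close> of the tails matches the
  Lyapunov function.\<close>

locale own_llr_signals = Fp: real_distribution Fp + Fm: real_distribution Fm
  for Fp Fm :: "real measure" and c :: real +
  assumes density_exp: "density Fm (\<lambda>s. ennreal (exp s)) = Fp"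
    and gap: "AE s in Fm. 2 \<le> \<bar>s\<bar>"
    and tail_Fm: "\<And>x. 0 \<le> x \<Longrightarrow> c * exp (- x / 2) \<le> measure Fm {..- x}"
    and tail_Fp: "\<And>x. 0 \<le> x \<Longrightarrow> c * exp (- x / 2) \<le> measure Fp {x<..}"
    and c_pos: "0 < c"
begin

section \<open>Absolute continuity and the law of the private log-likelihood ratio\<close>

lemma density_exp_minus: "density Fp (\<lambda>s. ennreal (exp (- s))) = Fm"
  unfolding density_exp[symmetric]
  by (subst density_density_eq) (auto simp: density_1 simp flip: ennreal_mult' exp_add)

lemma ac_Fm_Fp: "absolutely_continuous Fm Fp"
  by (subst density_exp[symmetric]) (simp add: absolutely_continuousI_density)

lemma ac_Fp_Fm: "absolutely_continuous Fp Fm"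
  by (subst density_exp_minus[symmetric]) (simp add: absolutely_continuousI_density)

lemma AE_Fp_if_AE_Fm: "AE s in Fm. P s \<Longrightarrow> AE s in Fp. P s"
  by (subst density_exp[symmetric]) (auto simp: AE_density elim: eventually_mono)

lemma llr_AE: "AE s in Fm. llr Fp Fm s = s"
proof -
  have "AE s in Fm. ennreal (exp s) = RN_deriv Fm Fp s"
    by (rule Fm.RN_deriv_unique[OF _ density_exp]) simp
  then show ?thesis
  proof eventually_elim
    case (elim s)
    show ?case unfolding llr_def elim[symmetric] by simp
  qed
qed

lemma measurable_llr[measurable]: "llr Fp Fm \<in> borel_measurable borel"
proof -
  have "RN_deriv Fm Fp \<in> borel_measurable borel"
    using borel_measurable_RN_deriv[of Fm Fp] by simp
  then show ?thesis unfolding llr_def by measurable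
qed

lemma Gp_eq: "Gp Fp Fm x = measure Fp {..x}"
  unfolding Gp_def using AE_Fp_if_AE_Fm[OF llr_AE]
  by (intro Fp.finite_measure_eq_AE) (auto elim: eventually_mono)

lemma Gm_eq: "Gm Fp Fm x = measure Fm {..x}"
  unfolding Gm_def using llr_AE
  by (intro Fm.finite_measure_eq_AE) (auto elim: eventually_mono)

lemma compl_Gp: "1 - Gp Fp Fm x = measure Fp {x<..}"
  using Fp.prob_compl[of "{..x}"] by (simp add: Gp_eq Compl_eq_Diff_UNIV[symmetric])

lemma compl_Gm: "1 - Gm Fp Fm x = measure Fm {x<..}"
  using Fm.prob_compl[of "{..x}"] by (simp add: Gm_eq Compl_eq_Diff_UNIV[symmetric])

lemma mono_Gp: "x \<le> y \<Longrightarrow> Gp Fp Fm x \<le> Gp Fp Fm y"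
  unfolding Gp_eq by (intro Fp.finite_measure_mono) auto

lemma mono_Gm: "x \<le> y \<Longrightarrow> Gm Fp Fm x \<le> Gm Fp Fm y"
  unfolding Gm_eq by (intro Fm.finite_measure_mono) auto

lemma measurable_G[measurable]:
  "Gp Fp Fm \<in> borel_measurable borel" "Gm Fp Fm \<in> borel_measurable borel"
  by (auto intro!: borel_measurable_mono monoI mono_Gp mono_Gm)

text \<open>Each tail is bounded below under one of the two measures only; mutual absolute
  continuity carries positivity over to the other.\<close>

lemma null_iff:
  assumes [measurable]: "X \<in> sets borel"
  shows "measure Fp X = 0 \<longleftrightarrow> measure Fm X = 0"
proof -
  have "null_sets Fp = null_sets Fm"
    using ac_Fm_Fp ac_Fp_Fm unfolding absolutely_continuous_def by (rule subset_antisym[rotated])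
  then have "X \<in> null_sets Fp \<longleftrightarrow> X \<in> null_sets Fm" by simp
  then show ?thesis
    by (simp add: null_sets_def Fp.emeasure_eq_measure Fm.emeasure_eq_measure)
qed

section \<open>Positivity and comparison of the tails\<close>

lemma Gm_pos: "0 < Gm Fp Fm x"
proof -
  have "0 < c * exp (- max 0 (- x) / 2)" using c_pos by simp
  also have "\<dots> \<le> Gm Fp Fm (- max 0 (- x))" unfolding Gm_eq by (rule tail_Fm) simp
  also have "\<dots> \<le> Gm Fp Fm x" by (rule mono_Gm) simp
  finally show ?thesis .
qed

lemma Gp_less_1: "Gp Fp Fm x < 1"
proof -
  have "0 < c * exp (- max 0 x / 2)" using c_pos by simp
  also have "\<dots> \<le> 1 - Gp Fp Fm (max 0 x)" unfolding compl_Gp by (rule tail_Fp) simp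
  also have "\<dots> \<le> 1 - Gp Fp Fm x" using mono_Gp[of x "max 0 x"] by simp
  finally show ?thesis by simp
qed

lemma Gp_pos: "0 < Gp Fp Fm x"
  using Gm_pos[of x] null_iff[of "{..x}"] by (simp add: Gp_eq Gm_eq zero_less_measure_iff)

lemma Gm_less_1: "Gm Fp Fm x < 1"
proof -
  have "measure Fp {x<..} > 0" using Gp_less_1[of x] compl_Gp[of x] by simp
  then have "measure Fm {x<..} > 0" using null_iff[of "{x<..}"] by (simp add: zero_less_measure_iff)
  then show ?thesis using compl_Gm[of x] by simp
qed

text \<open>Almost every signal in \<open>{..- x}\<close> is at most -2 by the gap and at most
  \<open>- x\<close> by definition; the density \<open>exp s\<close> is bounded accordingly.\<close>

lemma left_tail_le:
  assumes "0 \<le> x"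
  shows "Gp Fp Fm (- x) \<le> Gm Fp Fm (- x) / 4" "Gp Fp Fm (- x) \<le> exp (- x) * Gm Fp Fm (- x)"
proof -
  have pm: "prob_space Fm" "prob_space Fp" by unfold_locales
  have "measure Fp {..- x} \<le> (1 / 4) * measure Fm {..- x}"
  proof (rule measure_density_le[OF pm density_exp])
    show "AE s in Fm. s \<in> {..- x} \<longrightarrow> exp s \<le> 1 / 4" using gap
    proof eventually_elim
      case (elim s)
      have "exp s \<le> exp (- 2)" if "s \<le> - x" using that elim assms by simp
      also have "\<dots> \<le> 1 / 4" using exp_2_ge_4 by (simp add: exp_minus field_simps)
      finally show ?case by simp
    qed
  qed auto
  then show "Gp Fp Fm (- x) \<le> Gm Fp Fm (- x) / 4" by (simp add: Gp_eq Gm_eq)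
  show "Gp Fp Fm (- x) \<le> exp (- x) * Gm Fp Fm (- x)" unfolding Gp_eq Gm_eq
    by (rule measure_density_le[OF pm density_exp]) auto
qed

lemma right_tail_le:
  assumes "0 \<le> x"
  shows "1 - Gm Fp Fm x \<le> (1 - Gp Fp Fm x) / 4" "1 - Gm Fp Fm x \<le> exp (- x) * (1 - Gp Fp Fm x)"
proof -
  have pm: "prob_space Fm" "prob_space Fp" by unfold_locales
  have "measure Fm {x<..} \<le> (1 / 4) * measure Fp {x<..}"
  proof (rule measure_density_le[OF pm(2,1) density_exp_minus])
    show "AE s in Fp. s \<in> {x<..} \<longrightarrow> exp (- s) \<le> 1 / 4" using AE_Fp_if_AE_Fm[OF gap]
    proof eventually_elim
      case (elim s)
      have "exp (- s) \<le> exp (- 2)" if "x < s" using that elim assms by simp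
      also have "\<dots> \<le> 1 / 4" using exp_2_ge_4 by (simp add: exp_minus field_simps)
      finally show ?case by simp
    qed
  qed auto
  then show "1 - Gm Fp Fm x \<le> (1 - Gp Fp Fm x) / 4" by (simp add: compl_Gp compl_Gm)
  show "1 - Gm Fp Fm x \<le> exp (- x) * (1 - Gp Fp Fm x)" unfolding compl_Gp compl_Gm
    by (rule measure_density_le[OF pm(2,1) density_exp_minus]) auto
qed

lemma c_le_1: "c \<le> 1"
  using order_trans[OF tail_Fm[of 0] Fm.prob_le_1] by simp

lemma unbounded: "unbounded_signals Fp Fm"
  unfolding unbounded_signals_def
proof (intro allI conjI)
  fix M :: real
  let ?P = "measure Fp {s \<in> space Fp. llr Fp Fm s > M}"
  have "{s \<in> space Fp. llr Fp Fm s > M} = space Fp - {s \<in> space Fp. llr Fp Fm s \<le> M}"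
    by auto
  then have "?P = 1 - Gp Fp Fm M"
    unfolding Gp_def using Fp.prob_compl[of "{s \<in> space Fp. llr Fp Fm s \<le> M}"] by simp
  then have "0 < ?P" using Gp_less_1[of M] by simp
  then show "0 < (?P + measure Fm {s \<in> space Fm. llr Fp Fm s > M}) / 2"
    by (intro divide_pos_pos add_pos_nonneg) auto
  \<comment> \<open>The shift by 1 turns the weak inequality in \<open>Gm\<close> into a strict
    one.\<close>
  have "Gm Fp Fm (- M - 1) \<le> measure Fm {s \<in> space Fm. llr Fp Fm s < - M}"
    unfolding Gm_def by (intro Fm.finite_measure_mono) auto
  then have "0 < measure Fm {s \<in> space Fm. llr Fp Fm s < - M}"
    by (rule less_le_trans[OF Gm_pos])
  then show "0 < (measure Fp {s \<in> space Fp. llr Fp Fm s < - M}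
      + measure Fm {s \<in> space Fm. llr Fp Fm s < - M}) / 2"
    by (intro divide_pos_pos add_nonneg_pos) auto
qed

section \<open>Growth of the public log-likelihood ratio in each state\<close>

lemma pub_llr_rate_Fp:
  assumes r: "\<forall>\<^sub>F t in sequentially. c * (r t / real t) \<le> measure Fm {..- r t}"
  shows "AE s in PiM UNIV (\<lambda>_::nat. Fp).
    \<exists>d>0. \<forall>\<^sub>F t in sequentially. d * r t \<le> pub_llr Fp Fm s t"
proof -
  interpret belief_chain Fp "\<lambda>y. Gp Fp Fm (- y)" "\<lambda>y. Gm Fp Fm (- y)"
    "\<lambda>y s. y + llr Fp Fm s > 0" c
  proof
    show "Measurable.pred (borel \<Otimes>\<^sub>M Fp) (\<lambda>(y, s). 0 < y + llr Fp Fm s)"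
      by measurable
    show "measure Fp {s \<in> space Fp. \<not> 0 < y + llr Fp Fm s} = Gp Fp Fm (- y)" for y
      unfolding Gp_def by (rule arg_cong[where f = "measure Fp"]) auto
    show "c * exp (y / 2) \<le> 1 - Gp Fp Fm (- y)" if "y \<le> 0" for y
      using tail_Fp[of "- y"] that by (simp add: compl_Gp)
    show "1 - Gm Fp Fm (- y) \<le> (1 - Gp Fp Fm (- y)) / 4" if "y \<le> 0" for y
      using right_tail_le(1)[of "- y"] that by simp
  qed (use left_tail_le in \<open>auto simp: Gp_pos Gm_pos Gp_less_1 Gm_less_1 c_pos c_le_1\<close>)
  show ?thesis
  proof (rule belief_rate)
    show "antimono (\<lambda>y. Gm Fp Fm (- y))" by (auto intro!: antimonoI mono_Gm)
    show "\<forall>\<^sub>F t in sequentially. c * (r t / real t) \<le> Gm Fp Fm (- r t)"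
      using r by (simp add: Gm_eq)
    show "pub_llr Fp Fm s (Suc t) = chain (belief_step (\<lambda>y. Gp Fp Fm (- y)) (\<lambda>y. Gm Fp Fm (- y))
        (\<lambda>y s. y + llr Fp Fm s > 0)) 0 (\<lambda>i. s (Suc i)) t" for s t
      by (induction t) (simp_all add: Let_def belief_step_def Dp_def Dm_def)
  qed
qed

text \<open>The chain is now the negated public log-likelihood ratio, with +1 as the wrong action. A
  tie produces the action -1, which is correct here, so \<open>right\<close> is the exact negation
  of the rule for +1.\<close>

lemma pub_llr_rate_Fm:
  assumes r: "\<forall>\<^sub>F t in sequentially. c * (r t / real t) \<le> measure Fp {r t<..}"
  shows "AE s in PiM UNIV (\<lambda>_::nat. Fm).
    \<exists>d>0. \<forall>\<^sub>F t in sequentially. d * r t \<le> - pub_llr Fp Fm s t"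
proof -
  interpret belief_chain Fm "\<lambda>y. 1 - Gm Fp Fm y" "\<lambda>y. 1 - Gp Fp Fm y"
    "\<lambda>y s. \<not> - y + llr Fp Fm s > 0" c
  proof
    show "Measurable.pred (borel \<Otimes>\<^sub>M Fm) (\<lambda>(y, s). \<not> 0 < - y + llr Fp Fm s)"
      by measurable
    show "measure Fm {s \<in> space Fm. \<not> \<not> 0 < - y + llr Fp Fm s} = 1 - Gm Fp Fm y" for y
    proof -
      have "{s \<in> space Fm. \<not> \<not> 0 < - y + llr Fp Fm s} = space Fm - {s \<in> space Fm. llr Fp Fm s \<le> y}"
        by auto
      then show ?thesis
        unfolding Gm_def using Fm.prob_compl[of "{s \<in> space Fm. llr Fp Fm s \<le> y}"] by simp
    qed
    show "c * exp (y / 2) \<le> 1 - (1 - Gm Fp Fm y)" if "y \<le> 0" for y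
      using tail_Fm[of "- y"] that by (simp add: Gm_eq)
    show "1 - (1 - Gp Fp Fm y) \<le> (1 - (1 - Gm Fp Fm y)) / 4" if "y \<le> 0" for y
      using left_tail_le(1)[of "- y"] that by simp
  qed (use right_tail_le in \<open>auto simp: Gp_pos Gm_pos Gp_less_1 Gm_less_1 c_pos c_le_1\<close>)
  show ?thesis
  proof (rule belief_rate)
    show "antimono (\<lambda>y. 1 - Gp Fp Fm y)" by (auto intro!: antimonoI mono_Gp)
    show "\<forall>\<^sub>F t in sequentially. c * (r t / real t) \<le> 1 - Gp Fp Fm (r t)"
      using r by (simp add: compl_Gp)
    have neg_Dm: "- Dm Fp Fm (- y) = ln (Gm Fp Fm y / Gp Fp Fm y)" for y
      unfolding Dm_def using Gp_pos[of y] Gm_pos[of y] by (simp add: ln_div)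
    have neg_Dp: "- Dp Fp Fm (- y) = ln ((1 - Gm Fp Fm y) / (1 - Gp Fp Fm y))" for y
      unfolding Dp_def using Gp_less_1[of y] Gm_less_1[of y] by (simp add: ln_div)
    show "- pub_llr Fp Fm s (Suc t) = chain (belief_step (\<lambda>y. 1 - Gm Fp Fm y) (\<lambda>y. 1 - Gp Fp Fm y)
        (\<lambda>y s. \<not> - y + llr Fp Fm s > 0)) 0 (\<lambda>i. s (Suc i)) t" (is "_ = ?y t") for s t
    proof (induction t)
      case 0
      show ?case by simp
    next
      case (Suc t)
      define y where "y = ?y t"
      have "pub_llr Fp Fm s (Suc t) = - y" using Suc by (simp add: y_def)
      then have "- pub_llr Fp Fm s (Suc (Suc t)) =
          (if - y + llr Fp Fm (s (Suc t)) > 0 then y + - Dp Fp Fm (- y) else y + - Dm Fp Fm (- y))"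
        by (simp del: pub_llr.simps add: pub_llr.simps(2)[of _ _ _ "Suc t"] Let_def)
      also have "\<dots> = ?y (Suc t)"
        unfolding neg_Dp neg_Dm chain.simps y_def[symmetric] by (simp add: belief_step_def)
      finally show ?case .
    qed
  qed
qed

lemma measurable_pub_llr[measurable]:
  "(\<lambda>s. pub_llr Fp Fm s t) \<in> borel_measurable (PiM UNIV (\<lambda>_::nat. borel))"
proof (induction t)
  case (Suc t)
  have "Dp Fp Fm \<in> borel_measurable borel" "Dm Fp Fm \<in> borel_measurable borel"
    unfolding Dp_def[abs_def] Dm_def[abs_def] by measurable
  note this[measurable] Suc[measurable]
  show ?case unfolding pub_llr.simps Let_def by measurable
qed simp

text \<open>The rates in the two states combine through \<open>AE_bind\<close>, for which the event
  and the kernel must be measurable.\<close>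

lemma liminf_pub_llr_pos:
  assumes r: "\<forall>t\<ge>1. r t > 0"
    and rm: "\<forall>\<^sub>F t in sequentially. c * (r t / real t) \<le> measure Fm {..- r t}"
    and rp: "\<forall>\<^sub>F t in sequentially. c * (r t / real t) \<le> measure Fp {r t<..}"
  shows "AE s in signal_law Fp Fm. Liminf sequentially (\<lambda>t. ereal (\<bar>pub_llr Fp Fm s t\<bar> / r t)) > 0"
    (is "AE s in _. ?P s")
proof -
  have P: "?P s" if ex: "\<exists>d>0. \<forall>\<^sub>F t in sequentially. d * r t \<le> \<bar>pub_llr Fp Fm s t\<bar>" for s
  proof -
    obtain d where d: "d > 0" "\<forall>\<^sub>F t in sequentially. d * r t \<le> \<bar>pub_llr Fp Fm s t\<bar>"
      using ex by auto
    have "\<forall>\<^sub>F t in sequentially. ereal d \<le> ereal (\<bar>pub_llr Fp Fm s t\<bar> / r t)"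
      using d(2) eventually_ge_at_top[of 1] by eventually_elim (use r in \<open>simp add: field_simps\<close>)
    from Liminf_bounded[OF this] show ?thesis
      using d(1) by (simp add: less_le_trans[of 0 "ereal d"])
  qed
  have Pp: "AE s in PiM UNIV (\<lambda>_::nat. Fp). ?P s"
    using pub_llr_rate_Fp[OF rm]
  proof eventually_elim
    case (elim s)
    then show ?case by (intro P) (auto elim!: eventually_mono)
  qed
  have Pm: "AE s in PiM UNIV (\<lambda>_::nat. Fm). ?P s"
    using pub_llr_rate_Fm[OF rp]
  proof eventually_elim
    case (elim s)
    then show ?case by (intro P) (auto elim!: eventually_mono)
  qed
  have "Measurable.pred (PiM UNIV (\<lambda>_::nat. borel)) ?P"
    by measurable
  moreover have "(\<lambda>\<theta>. PiM UNIV (\<lambda>_::nat. if \<theta> then Fp else Fm))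
      \<in> measure_pmf (bernoulli_pmf (1/2)) \<rightarrow>\<^sub>M subprob_algebra (PiM UNIV (\<lambda>_::nat. borel))"
  proof -
    have "PiM UNIV (\<lambda>_::nat. if \<theta> then Fp else Fm) \<in> space (subprob_algebra (PiM UNIV (\<lambda>_::nat. borel)))" for \<theta>
    proof -
      have "prob_space (PiM UNIV (\<lambda>_::nat. if \<theta> then Fp else Fm))"
        by (intro prob_space_PiM) (simp add: Fp.prob_space_axioms Fm.prob_space_axioms)
      then show ?thesis
        by (auto simp: space_subprob_algebra prob_space_imp_subprob_space intro!: sets_PiM_cong)
    qed
    then show ?thesis by simp
  qed
  ultimately show ?thesis
    unfolding signal_law_def using Pp Pm by (subst AE_bind) (auto intro!: AE_I2)
qed

end

section \<open>Signals with slowly decaying tails\<close>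

text \<open>For fixed \<open>u > 0\<close> only finitely many \<open>t\<close> satisfy
  \<open>u < r t / t\<close>. The sum of their \<open>r t\<close> is finite, dominates each of them,
  and is measurable in \<open>u\<close> as a series.\<close>

lemma slow_quantile_exists:
  fixes r :: "nat \<Rightarrow> real"
  assumes r: "\<forall>t\<ge>1. r t > 0" and lim: "((\<lambda>t. r t / real t) \<longlongrightarrow> 0) sequentially"
  obtains q :: "real \<Rightarrow> real" where "q \<in> borel_measurable borel" "\<And>u. u > 0 \<Longrightarrow> q u \<ge> 0"
    "\<And>u t. u > 0 \<Longrightarrow> t \<ge> 1 \<Longrightarrow> u < r t / real t \<Longrightarrow> r t \<le> q u"
proof
  \<comment> \<open>The successor skips \<open>t = 0\<close>, where \<open>r\<close> need not be
    positive.\<close>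
  define f where "f u t = (if u < r (Suc t) / real (Suc t) then r (Suc t) else 0)" for u t
  define q where "q u = suminf (f u)" for u
  have nonneg: "f u t \<ge> 0" for u t using r[rule_format, of "Suc t"] by (simp add: f_def less_imp_le)
  have sum: "summable (f u)" if "u > 0" for u
  proof -
    have "\<forall>\<^sub>F t in sequentially. r (Suc t) / real (Suc t) < u"
      using order_tendstoD(2)[OF lim that] by (subst eventually_sequentially_Suc)
    then have "\<forall>\<^sub>F t in sequentially. f u t = 0" by eventually_elim (simp add: f_def)
    then have "finite {t. f u t \<noteq> 0}"
      by (simp add: eventually_cofinite cofinite_eq_sequentially[symmetric])
    then show ?thesis by (rule summable_finite) auto
  qed
  show "q \<in> borel_measurable borel" unfolding q_def f_def by measurable
  show "q u \<ge> 0" if "u > 0" for u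
    unfolding q_def by (rule suminf_nonneg[OF sum[OF that] nonneg])
  show "r t \<le> q u" if "u > 0" "t \<ge> 1" "u < r t / real t" for u t
  proof -
    have "r t = (\<Sum>i\<in>{t - 1}. f u i)" using that by (simp add: f_def)
    also have "\<dots> \<le> q u" unfolding q_def by (rule sum_le_suminf[OF sum[OF that(1)] _ nonneg]) simp
    finally show ?thesis .
  qed
qed

text \<open>Logistic weights at \<open>x\<close> and \<open>- x\<close> thus sum to 1 and have ratio
  \<open>exp x\<close>: the first normalizes the densities \<open>g\<close>, the second gives their
  likelihood ratio.\<close>

lemma logistic_minus: "1 / (1 + exp (- x)) = exp x / (1 + exp x)" for x :: real
proof -
  have "1 + exp x \<noteq> 0" "1 + exp (- x) \<noteq> 0"
    using exp_gt_zero[of x] exp_gt_zero[of "- x"] by linarith+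
  then show ?thesis by (simp add: frac_eq_eq distrib_left flip: exp_add)
qed

lemma slow_signals_exist:
  fixes r :: "nat \<Rightarrow> real"
  assumes r: "\<forall>t\<ge>1. r t > 0" and lim: "((\<lambda>t. r t / real t) \<longlongrightarrow> 0) sequentially"
  obtains Fp Fm where "own_llr_signals Fp Fm (1 / 2)"
    "\<forall>\<^sub>F t in sequentially. 1 / 2 * (r t / real t) \<le> measure Fm {..- r t}"
    "\<forall>\<^sub>F t in sequentially. 1 / 2 * (r t / real t) \<le> measure Fp {r t<..}"
proof -
  obtain q where q[measurable]: "q \<in> borel_measurable borel" and q0: "\<And>u. u > 0 \<Longrightarrow> q u \<ge> 0"
    and qr: "\<And>u t. u > 0 \<Longrightarrow> t \<ge> 1 \<Longrightarrow> u < r t / real t \<Longrightarrow> r t \<le> q u"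
    using slow_quantile_exists[OF r lim] by blast
  \<comment> \<open>\<open>Q\<close> is a quantile function for \<open>\<bar>s\<bar>\<close>: the bound \<open>2\<close> keeps the signals away from \<open>0\<close>, the
    logarithm provides the exponential tail and \<open>q\<close> the tail \<open>r\<^sub>t / t\<close> at \<open>r\<^sub>t\<close>. The signal is \<open>S u\<close>
    with \<open>u\<close> of density \<open>g 1\<close> (for \<open>\<theta> = -1\<close>) or \<open>g (- 1)\<close> (for \<open>\<theta> = +1\<close>), whose ratio is \<open>exp (S u)\<close>.\<close>
  define Q where "Q u = 2 - 2 * ln u + q u" for u
  define S where "S u = sgn u * Q \<bar>u\<bar>" for u
  define g where "g v u = indicator {-1<..<1} u / (1 + exp (v * S u))" for v u :: real
  define F where "F v = distr (density lborel (\<lambda>u. ennreal (g v u))) borel S" for v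
  have Qm[measurable]: "Q \<in> borel_measurable borel" unfolding Q_def by measurable
  have Sm[measurable]: "S \<in> borel_measurable borel" unfolding S_def by measurable
  have gm[measurable]: "g v \<in> borel_measurable borel" for v unfolding g_def by measurable
  have g0: "g v u \<ge> 0" for v u by (simp add: g_def add_nonneg_nonneg)
  have Q_ge: "2 - 2 * ln u \<le> Q u" "2 + q u \<le> Q u" "2 \<le> Q u" if "0 < u" "u < 1" for u
    using q0[OF that(1)] ln_less_zero[OF that] by (auto simp: Q_def)
  have exp_pos1: "1 + exp x \<noteq> 0" for x :: real using exp_gt_zero[of x] by linarith

  \<comment> \<open>As \<open>S\<close> is odd, the reflection of \<open>u\<close> exchanges
    \<open>g v\<close> and \<open>g (- v)\<close>, so both have the same integral. Their sum is the
    indicator of an interval of length 2.\<close>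
  have prob: "prob_space (F v)" for v
  proof -
    define I where "I v = (\<integral>\<^sup>+u. ennreal (g v u) \<partial>lborel)" for v
    have "I v = (\<integral>\<^sup>+u. ennreal (g v (0 + (- 1) * u)) \<partial>lborel)"
      unfolding I_def by (subst nn_integral_real_affine[where c = "- 1" and t = 0]) auto
    also have "\<dots> = I (- v)"
      unfolding I_def by (intro nn_integral_cong) (auto simp: g_def S_def indicator_def)
    finally have "I v + I v = I v + I (- v)" by simp
    also have "\<dots> = (\<integral>\<^sup>+u. ennreal (g v u) + ennreal (g (- v) u) \<partial>lborel)"
      unfolding I_def by (subst nn_integral_add) auto
    also have "\<dots> = (\<integral>\<^sup>+(u::real). indicator {-1<..<1} u \<partial>lborel)"
    proof (intro nn_integral_cong)
      fix u :: real
      have "g v u + g (- v) u = indicator {-1<..<1} u"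
        unfolding g_def using logistic_minus[of "v * S u"] exp_pos1[of "v * S u"]
        by (simp add: indicator_def flip: add_divide_distrib)
      then show "ennreal (g v u) + ennreal (g (- v) u) = indicator {-1<..<1} u"
        using g0 by (simp add: indicator_def flip: ennreal_plus)
    qed
    also have "\<dots> = 2" by simp
    finally have "I v = 1"
      by (cases "I v") (auto simp flip: ennreal_plus ennreal_numeral ennreal_1)
    then show ?thesis
      unfolding F_def
      by (intro prob_space.prob_space_distr prob_spaceI) (auto simp: emeasure_density I_def)
  qed
  then have dist: "real_distribution (F v)" for v
    unfolding real_distribution_def real_distribution_axioms_def by (simp add: F_def)

  \<comment> \<open>Where \<open>v * S u\<close> is negative the weight \<open>g v u\<close> is at
    least \<open>1 / 2\<close>, and the event contains an interval of \<open>u\<close> of length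
    \<open>b\<close>.\<close>
  have tail: "b / 2 \<le> measure (F v) {s. v * s < - x}"
    if v: "v = 1 \<or> v = - 1" and x: "0 \<le> x" and b: "0 \<le> b" "b \<le> 1"
      and Qx: "\<And>u. 0 < u \<Longrightarrow> u < b \<Longrightarrow> x < Q u" for v x b
  proof -
    interpret prob_space "F v" by (rule prob)
    let ?J = "{u. 0 < - v * u \<and> - v * u < b}"
    have "?J = {-b<..<0} \<or> ?J = {0<..<b}" using v by auto
    then have J: "emeasure lborel ?J = ennreal b" "?J \<in> sets lborel" using b by auto
    have "ennreal (b / 2) = ennreal (1 / 2) * emeasure lborel ?J"
      unfolding J(1) using b by (subst ennreal_mult'[symmetric]) auto
    also have "\<dots> = (\<integral>\<^sup>+u. ennreal (1 / 2) * indicator ?J u \<partial>lborel)"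
      using J by (subst nn_integral_cmult) auto
    also have "\<dots> \<le> (\<integral>\<^sup>+u. ennreal (g v u) * indicator (S -` {s. v * s < - x}) u \<partial>lborel)"
    proof (intro nn_integral_mono)
      fix u
      show "ennreal (1 / 2) * indicator ?J u \<le> ennreal (g v u) * indicator (S -` {s. v * s < - x}) u"
      proof (cases "u \<in> ?J")
        case True
        then have u: "- v * u = \<bar>u\<bar>" "0 < \<bar>u\<bar>" "\<bar>u\<bar> < b" "v * sgn u = - 1"
          using v by auto
        have "v * S u = - Q \<bar>u\<bar>" unfolding S_def using u(4) by (simp add: mult.assoc[symmetric])
        then have *: "v * S u < - x" using Qx[OF u(2,3)] by simp
        then have "exp (v * S u) \<le> 1" using x by simp
        then have "1 / 2 \<le> 1 / (1 + exp (v * S u))"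
          by (intro divide_left_mono) (auto simp: add_pos_pos)
        also have "\<dots> = g v u" using u b by (auto simp: g_def indicator_def)
        finally have "ennreal (1 / 2) \<le> ennreal (g v u)" by (rule ennreal_leI)
        then show ?thesis using * True by (simp add: indicator_def)
      qed simp
    qed
    also have "\<dots> = emeasure (F v) {s. v * s < - x}"
      unfolding F_def by (subst emeasure_distr) (auto simp: emeasure_density)
    finally show ?thesis by (simp add: emeasure_eq_measure)
  qed

  have tails: "b / 2 \<le> measure (F 1) {..- x}" "b / 2 \<le> measure (F (- 1)) {x<..}"
    if "0 \<le> x" "0 \<le> b" "b \<le> 1" "\<And>u. 0 < u \<Longrightarrow> u < b \<Longrightarrow> x < Q u" for x b
  proof -
    interpret F: prob_space "F v" for v by (rule prob)
    have "measure (F 1) {s. 1 * s < - x} \<le> measure (F 1) {..- x}"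
      by (intro F.finite_measure_mono) (auto simp: F_def)
    then show "b / 2 \<le> measure (F 1) {..- x}" using tail[of 1 x b] that by simp
    have "{s. - 1 * s < - x} = {x<..}" by auto
    then show "b / 2 \<le> measure (F (- 1)) {x<..}" using tail[of "- 1" x b] that by metis
  qed

  have exp_tails: "1 / 2 * exp (- x / 2) \<le> measure (F 1) {..- x}"
    "1 / 2 * exp (- x / 2) \<le> measure (F (- 1)) {x<..}" if "0 \<le> x" for x
  proof -
    have "x < Q u" if u: "0 < u" "u < exp (- x / 2)" for u
    proof -
      have "ln u < - x / 2" using u by (metis exp_less_cancel_iff exp_ln)
      moreover have "u < 1" using u(2) \<open>0 \<le> x\<close> by (smt (verit) exp_le_one_iff divide_nonpos_pos)
      ultimately show ?thesis using Q_ge(1)[of u] u by simp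
    qed
    then show "1 / 2 * exp (- x / 2) \<le> measure (F 1) {..- x}"
      "1 / 2 * exp (- x / 2) \<le> measure (F (- 1)) {x<..}"
      using tails[of x "exp (- x / 2)"] that by auto
  qed

  have "\<forall>\<^sub>F t in sequentially. r t / real t < 1"
    using order_tendstoD(2)[OF lim, of 1] by simp
  then have r_tails: "\<forall>\<^sub>F t in sequentially. 1 / 2 * (r t / real t) \<le> measure (F 1) {..- r t} \<and>
      1 / 2 * (r t / real t) \<le> measure (F (- 1)) {r t<..}"
    using eventually_ge_at_top[of 1]
  proof eventually_elim
    case (elim t)
    have rt: "r t > 0" using r elim by simp
    have "r t < Q u" if "0 < u" "u < r t / real t" for u
      using Q_ge(2)[of u] qr[of u t] that elim by simp
    then show ?case using tails[of "r t" "r t / real t"] rt elim by (simp add: less_imp_le)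
  qed

  have "own_llr_signals (F (- 1)) (F 1) (1 / 2)"
  proof (intro own_llr_signals.intro own_llr_signals_axioms.intro dist exp_tails)
    have "g 1 u * exp (S u) = g (- 1) u" for u
      unfolding g_def using logistic_minus[of "S u"] by (simp add: indicator_def)
    then show "density (F 1) (\<lambda>s. ennreal (exp s)) = F (- 1)"
      unfolding F_def using g0
      by (simp add: density_distr density_density_eq flip: ennreal_mult')
    \<comment> \<open>The point 0 must be excluded because \<open>sgn\<close> makes
      \<open>S 0 = 0\<close> there.\<close>
    have "AE u in lborel. u \<noteq> (0::real)" by (rule AE_lborel_singleton)
    then have "AE u in lborel. 0 < ennreal (g 1 u) \<longrightarrow> 2 \<le> \<bar>S u\<bar>"
    proof eventually_elim
      case (elim u)
      have "2 \<le> \<bar>S u\<bar>" if "u \<in> {-1<..<1}"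
      proof -
        have "2 \<le> Q \<bar>u\<bar>" using elim that by (intro Q_ge(3)) auto
        then show ?thesis using elim by (simp add: S_def abs_mult abs_sgn_eq)
      qed
      then show ?case by (auto simp: g_def indicator_def)
    qed
    then show "AE s in F 1. 2 \<le> \<bar>s\<bar>"
      unfolding F_def by (subst AE_distr_iff) (auto simp: AE_density)
  qed auto
  then show thesis
    using r_tails by (intro that[of "F (- 1)" "F 1"]) (auto elim: eventually_mono)
qed

theorem theorem2:
  fixes r :: "nat \<Rightarrow> real"
  assumes "\<forall>t\<ge>1. r t > 0"
    and "((\<lambda>t. r t / real t) \<longlongrightarrow> 0) sequentially"
  shows "\<exists>Fp Fm :: real measure.
           real_distribution Fp \<and> real_distribution Fm \<and>
           absolutely_continuous Fp Fm \<and> absolutely_continuous Fm Fp \<and>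
           unbounded_signals Fp Fm \<and>
           (AE s in signal_law Fp Fm.
              Liminf sequentially (\<lambda>t. ereal (\<bar>pub_llr Fp Fm s t\<bar> / r t)) > 0)"
proof -
  obtain Fp Fm where F: "own_llr_signals Fp Fm (1 / 2)"
    and tails: "\<forall>\<^sub>F t in sequentially. 1 / 2 * (r t / real t) \<le> measure Fm {..- r t}"
      "\<forall>\<^sub>F t in sequentially. 1 / 2 * (r t / real t) \<le> measure Fp {r t<..}"
    using slow_signals_exist[OF assms] by blast
  interpret own_llr_signals Fp Fm "1 / 2" by fact
  show ?thesis
    using Fp.real_distribution_axioms Fm.real_distribution_axioms ac_Fp_Fm ac_Fm_Fp unbounded
      liminf_pub_llr_pos[OF assms(1) tails] by blast
qed

end
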